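(* Let $\mathcal C$ be an $\mathbb F_{q^n}$-linear rank metric code of dimension $k>2$ contained in $\mathcal L_{n,q}$, with $\mathcal C\cap\mathcal U_1=\{0\}$. Suppose there exists an integer $s$ with $\gcd(s,n)=1$ such that: (1) $\dim(\mathcal C\cap\mathcal C^{[s]})=k-2$ and $\dim(\mathcal C\cap\mathcal C^{[s]}\cap\mathcal C^{[2s]})=k-3$; that is, there exist $p(x),q(x)\in\mathcal L_{n,q}$, with $q(x)\in\mathcal C$, such that \[\mathcal C=\langle p(x)^{[s]},p(x)^{[2s]},\ldots,p(x)^{[s(k-1)]}\rangle_{\mathbb F_{q^n}}\oplus\langle q(x)\rangle_{\mathbb F_{q^n}};\] (2) $p(x)$ is invertible and there exists $\eta\in\mathbb F_{q^n}^*$ such that $p(x)+\eta\,p(x)^{[sk]}\in\mathcal C$ and $\mathrm N_{q^n/q}(\eta)\neq(-1)^{kn}$. Then $\mathcal C$ is an MRD code equivalent to $\mathcal H_{k,s}(\eta)$.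
   Context: $q$ is a prime power, $[i]:=q^i$. $\mathcal L_{n,q}$ is the $\mathbb F_{q^n}$-vector space of linearized polynomials $f(x)=\sum_{i=0}^{n-1}a_ix^{[i]}$, $a_i\in\mathbb F_{q^n}$, identified with $\mathbb F_q$-linear maps of $\mathbb F_{q^n}$ (rank = $\mathbb F_q$-dimension of the image). $\mathcal U_1$ is the set of elements of rank at most one. For $f(x)=\sum_i a_ix^{[i]}$, $f(x)^{[j]}:=x^{[j]}\circ f(x)=\sum_i a_i^{[j]}x^{[(i+j)\bmod n]}$, and $\mathcal C^{[j]}=\{f^{[j]}\colon f\in\mathcal C\}$. A code (an $\mathbb F_q$-subspace of $\mathcal L_{n,q}$ with rank distance $\mathrm{rk}(f-g)$, minimum distance $d$) is MRD if $|\mathcal C|=q^{n(n-d+1)}$. $\mathrm N_{q^n/q}(\eta)=\prod_{i=0}^{n-1}\eta^{[i]}$. $\mathcal H_{k,s}(\eta)=\langle x+\eta x^{[sk]},x^{[s]},\ldots,x^{[s(k-1)]}\rangle_{\mathbb F_{q^n}}$. Codes $\mathcal C,\mathcal C'$ are equivalent if there are invertible $h,g\in\mathcal L_{n,q}$ and a field automorphism $\sigma$ (acting on coefficients) with $\{h\circ f^\sigma\circ g\colon f\in\mathcal C\}=\mathcal C'$. *)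

theory Defs
  imports Complex_Main "HOL-Library.Function_Algebras" "HOL-Computational_Algebra.Primes"
begin

text \<open>The field F_{q^n} is a finite field type 'a with CARD('a) = q^n.
  Linearized polynomials are identified with the F_q-linear maps 'a => 'a
  (as in the paper), so that the code space L_{n,q} is a set of functions.\<close>

definition prime_power :: "nat \<Rightarrow> bool" where
  "prime_power q \<longleftrightarrow> (\<exists>p r. prime p \<and> r > 0 \<and> q = p ^ r)"

definition Fq :: "nat \<Rightarrow> 'a::field set" where
  "Fq q = {x. x ^ q = x}"

definition Lnq :: "nat \<Rightarrow> ('a::field \<Rightarrow> 'a) set" where
  "Lnq q = {f. (\<forall>x y. f (x + y) = f x + f y) \<and> (\<forall>c\<in>Fq q. \<forall>x. f (c * x) = c * f x)}"

definition scl :: "'a::field \<Rightarrow> ('a \<Rightarrow> 'a) \<Rightarrow> ('a \<Rightarrow> 'a)" where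
  "scl c f = (\<lambda>x. c * f x)"

abbreviation span_L :: "('a::field \<Rightarrow> 'a) set \<Rightarrow> ('a \<Rightarrow> 'a) set" where
  "span_L S \<equiv> module.span scl S"

abbreviation dim_L :: "('a::field \<Rightarrow> 'a) set \<Rightarrow> nat" where
  "dim_L S \<equiv> vector_space.dim scl S"

text \<open>x^{[j]} for an integer j (indices taken mod n, as q^n-th power is the identity).\<close>
definition xq :: "nat \<Rightarrow> nat \<Rightarrow> int \<Rightarrow> 'a::field \<Rightarrow> 'a" where
  "xq q n j = (\<lambda>x. x ^ (q ^ nat (j mod int n)))"

definition twist :: "nat \<Rightarrow> nat \<Rightarrow> int \<Rightarrow> ('a::field \<Rightarrow> 'a) \<Rightarrow> ('a \<Rightarrow> 'a)" where
  "twist q n j f = xq q n j \<circ> f"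

definition twist_code :: "nat \<Rightarrow> nat \<Rightarrow> int \<Rightarrow> ('a::field \<Rightarrow> 'a) set \<Rightarrow> ('a \<Rightarrow> 'a) set" where
  "twist_code q n j C = twist q n j ` C"

definition Fq_span :: "nat \<Rightarrow> 'a::field set \<Rightarrow> 'a set" where
  "Fq_span q B = {(\<Sum>b\<in>B. c b * b) | c. \<forall>b\<in>B. c b \<in> Fq q}"

definition Fq_dim :: "nat \<Rightarrow> 'a::field set \<Rightarrow> nat" where
  "Fq_dim q S = (LEAST r. \<exists>B. finite B \<and> card B = r \<and> B \<subseteq> S \<and> Fq_span q B = S)"

definition rk :: "nat \<Rightarrow> ('a::field \<Rightarrow> 'a) \<Rightarrow> nat" where
  "rk q f = Fq_dim q (range f)"

definition U1 :: "nat \<Rightarrow> ('a::field \<Rightarrow> 'a) set" where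
  "U1 q = {f \<in> Lnq q. rk q f \<le> 1}"

definition min_dist :: "nat \<Rightarrow> ('a::field \<Rightarrow> 'a) set \<Rightarrow> nat" where
  "min_dist q C = Min {rk q (f - g) | f g. f \<in> C \<and> g \<in> C \<and> f \<noteq> g}"

definition MRD :: "nat \<Rightarrow> nat \<Rightarrow> ('a::field \<Rightarrow> 'a) set \<Rightarrow> bool" where
  "MRD q n C \<longleftrightarrow> card C = q ^ (n * (n - min_dist q C + 1))"

definition normq :: "nat \<Rightarrow> nat \<Rightarrow> 'a::field \<Rightarrow> 'a" where
  "normq q n \<eta> = (\<Prod>i<n. \<eta> ^ (q ^ i))"

definition field_aut :: "('a::field \<Rightarrow> 'a) \<Rightarrow> bool" where
  "field_aut \<sigma> \<longleftrightarrow> bij \<sigma> \<and> (\<forall>x y. \<sigma> (x + y) = \<sigma> x + \<sigma> y) \<and> (\<forall>x y. \<sigma> (x * y) = \<sigma> x * \<sigma> y)"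

text \<open>f^sigma (sigma applied to the coefficients of f): as a map, x \<mapsto> sigma(f(sigma^{-1} x)).\<close>
definition coeff_aut :: "('a \<Rightarrow> 'a) \<Rightarrow> ('a \<Rightarrow> 'a) \<Rightarrow> ('a \<Rightarrow> 'a)" where
  "coeff_aut \<sigma> f = \<sigma> \<circ> f \<circ> inv \<sigma>"

definition equivalent_codes :: "nat \<Rightarrow> ('a::field \<Rightarrow> 'a) set \<Rightarrow> ('a \<Rightarrow> 'a) set \<Rightarrow> bool" where
  "equivalent_codes q C C' \<longleftrightarrow>
     (\<exists>h g \<sigma>. h \<in> Lnq q \<and> bij h \<and> g \<in> Lnq q \<and> bij g \<and> field_aut \<sigma> \<and>
        (\<lambda>f. h \<circ> coeff_aut \<sigma> f \<circ> g) ` C = C')"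

definition H_code :: "nat \<Rightarrow> nat \<Rightarrow> nat \<Rightarrow> int \<Rightarrow> 'a::field \<Rightarrow> ('a \<Rightarrow> 'a) set" where
  "H_code q n k s \<eta> = span_L (insert (\<lambda>x. x + \<eta> * xq q n (s * int k) x)
                                {xq q n (s * int i) | i. 1 \<le> i \<and> i \<le> k - 1})"

end

(*
  Let sigma be the automorphism x |-> x^(q^t) of F_(q^n), where t = s mod n; as gcd(t, n) = 1,
  its fixed field is F_q. A sigma-polynomial a_0 x + a_1 x^sigma + ... + a_k x^(sigma^k) with
  a_k /= 0 has at most q^k roots, and exactly q^k only if N(a_0) = (-1)^(nk) N(a_k): at a nonzero
  root u it splits off the right factor x^sigma - c x with c = u^sigma / u, which has N(c) = 1 and
  the q roots u F_q, so induction on k applies. The elements of H_(k,s)(eta) are the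
  sigma-polynomials of degree k with a_k = eta a_0, so the condition on N(eta) bounds the kernel
  of every nonzero element by q^(k-1): its rank is at least n - k + 1, and H_(k,s)(eta) is MRD.
  The hypotheses put H_(k,s)(eta) o p inside C; as k < n (otherwise the Singleton bound would
  give a nonzero element of C of rank at most one), both have q^(nk) elements, so
  C = H_(k,s)(eta) o p, which is MRD and equivalent to H_(k,s)(eta) via the map g = p^(-1).
*)

theory Submission
  imports Defs "HOL-Computational_Algebra.Polynomial" "HOL-Library.FuncSet"
begin

section \<open>Finite fields and additive maps\<close>

lemma finite_field_power_card:
  fixes x :: "'a::{field,finite}"
  shows "x ^ card (UNIV :: 'a set) = x"
proof (cases "x = 0")
  case False
  have "x * (\<Prod>y\<in>UNIV-{0}. x * y) = x * x ^ (card (UNIV :: 'a set) - 1) * \<Prod>(UNIV-{0})"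
    by (simp add: prod.distrib mult_ac)
  also have "x * x ^ (card (UNIV :: 'a set) - 1) = x ^ Suc (card (UNIV :: 'a set) - 1)"
    by (subst power_Suc) auto
  also have "Suc (card (UNIV :: 'a set) - 1) = card (UNIV :: 'a set)"
    using finite_UNIV_card_ge_0[where ?'a = 'a] by simp
  also have "(\<Prod>y\<in>UNIV-{0}. x * y) = (\<Prod>y\<in>UNIV-{0}. y)"
    by (rule prod.reindex_bij_witness[of _ "\<lambda>y. y / x" "\<lambda>y. x * y"]) (use False in auto)
  finally show ?thesis
    by simp
qed (use finite_UNIV_card_ge_0[where ?'a = 'a] in auto)

text \<open>Translation by \<open>1\<close> permutes the ring, so \<open>card \<cdot> 1 = \<Sum>(x + 1) - \<Sum>x = 0\<close>.\<close>

lemma CHAR_dvd_card: "CHAR('a::{ring_1,finite}) dvd card (UNIV :: 'a set)"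
proof -
  have "(\<Sum>x\<in>UNIV. x + 1) = (\<Sum>x\<in>UNIV. x :: 'a)"
    by (rule sum.reindex_bij_witness[of _ "\<lambda>x. x - 1" "\<lambda>x. x + 1"]) auto
  then have "of_nat (card (UNIV :: 'a set)) = (0 :: 'a)"
    by (simp add: sum.distrib)
  then show ?thesis
    by (simp add: of_nat_eq_0_iff_char_dvd)
qed

lemma power_power_fixed_mult:
  fixes x :: "'a::monoid_mult"
  assumes "x ^ (q ^ j) = x"
  shows "x ^ (q ^ (j * m)) = x"
proof (induction m)
  case (Suc m)
  have "x ^ (q ^ (j * Suc m)) = (x ^ (q ^ (j * m))) ^ (q ^ j)"
    by (simp add: power_add power_mult[symmetric] mult.commute)
  then show ?case using Suc assms by simp
qed simp

lemma card_additive_fiber: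
  assumes "additive f" and "y \<in> range f"
  shows "card (f -` {y}) = card {x. f x = 0}"
proof -
  interpret additive f by fact
  obtain x0 where y: "y = f x0" using assms(2) by auto
  have "f -` {y} = (\<lambda>z. z + x0) ` {x. f x = 0}"
  proof (intro equalityI subsetI)
    fix x assume "x \<in> f -` {y}"
    then have "f (x - x0) = 0" using y by (simp add: diff)
    then show "x \<in> (\<lambda>z. z + x0) ` {x. f x = 0}" by (intro image_eqI[of _ _ "x - x0"]) auto
  qed (use y in \<open>auto simp: add\<close>)
  moreover have "inj_on (\<lambda>z. z + x0) {x. f x = 0}" by (auto simp: inj_on_def)
  ultimately show ?thesis by (simp add: card_image)
qed

lemma card_range_mult_card_kernel:
  fixes f :: "'a::{ab_group_add,finite} \<Rightarrow> 'b::ab_group_add"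
  assumes "additive f"
  shows "card (range f) * card {x. f x = 0} = card (UNIV :: 'a set)"
proof -
  have "card (UNIV :: 'a set) = card (\<Union>y\<in>range f. f -` {y})" by (rule arg_cong[of _ _ card]) auto
  also have "\<dots> = (\<Sum>y\<in>range f. card (f -` {y}))" by (rule card_UN_disjoint) auto
  also have "\<dots> = (\<Sum>y\<in>range f. card {x. f x = 0})" using card_additive_fiber[OF assms] by simp
  finally show ?thesis by simp
qed

lemma card_le_card_kernel_mult_card_image:
  fixes f :: "'a::{ab_group_add,finite} \<Rightarrow> 'b::ab_group_add"
  assumes "additive f"
  shows "card A \<le> card {x. f x = 0} * card (f ` A)"
proof -
  have "card A \<le> card (\<Union>y\<in>f ` A. f -` {y})" by (intro card_mono) auto
  also have "\<dots> \<le> (\<Sum>y\<in>f ` A. card (f -` {y}))" by (rule card_UN_le) simp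
  also have "\<dots> = (\<Sum>y\<in>f ` A. card {x. f x = 0})"
    using card_additive_fiber[OF assms] by (intro sum.cong) auto
  finally show ?thesis by (simp add: mult.commute)
qed

section \<open>Spaces of maps\<close>

text \<open>\<open>span_L\<close> and \<open>dim_L\<close> are \<open>L.span\<close> and \<open>L.dim\<close> of this interpretation.\<close>

interpretation L: vector_space "scl :: 'a::field \<Rightarrow> ('a \<Rightarrow> 'a) \<Rightarrow> 'a \<Rightarrow> 'a"
  by unfold_locales (auto simp: scl_def fun_eq_iff algebra_simps)

lemma sum_fun_apply: "(\<Sum>i\<in>A. f i) x = (\<Sum>i\<in>A. (f i :: 'a \<Rightarrow> 'b::comm_monoid_add) x)"
  by (induction A rule: infinite_finite_induct) auto

lemma card_span_L_independent:
  fixes B :: "('a::{field,finite} \<Rightarrow> 'a) set"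
  assumes ind: "\<not> L.dependent B"
  shows "card (span_L B) = card (UNIV :: 'a set) ^ card B"
proof -
  have fB: "finite B" by simp
  let ?comb = "\<lambda>u. \<Sum>v\<in>B. scl (u v) v"
  have span_eq: "span_L B = ?comb ` (PiE B (\<lambda>_. UNIV))"
  proof -
    have "span_L B = range ?comb" by (rule L.span_finite[OF fB])
    also have "\<dots> = ?comb ` (PiE B (\<lambda>_. UNIV))"
    proof (intro equalityI subsetI)
      fix x assume "x \<in> range ?comb"
      then obtain u where "x = ?comb u" by blast
      then show "x \<in> ?comb ` (PiE B (\<lambda>_. UNIV))"
        by (intro image_eqI[of _ _ "restrict u B"]) (auto intro!: sum.cong)
    qed auto
    finally show ?thesis .
  qed
  have inj: "inj_on ?comb (PiE B (\<lambda>_. UNIV))"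
  proof (rule inj_onI)
    fix u w assume u: "u \<in> PiE B (\<lambda>_. UNIV)" and w: "w \<in> PiE B (\<lambda>_. UNIV)"
      and uw: "?comb u = ?comb w"
    have "(\<Sum>v\<in>B. scl (u v - w v) v) = 0"
      using uw by (simp add: L.scale_left_diff_distrib sum_subtractf)
    then have "\<forall>v\<in>B. u v - w v = 0"
      using L.independentD[OF ind fB subset_refl, of "\<lambda>v. u v - w v"] by blast
    then show "u = w" using u w by (intro PiE_ext) auto
  qed
  have "card (span_L B) = card (PiE B (\<lambda>_. UNIV :: 'a set))"
    unfolding span_eq by (rule card_image[OF inj])
  also have "\<dots> = card (UNIV :: 'a set) ^ card B"
    using fB by (simp add: card_PiE)
  finally show ?thesis .
qed

lemma card_subspace_L:
  fixes C :: "('a::{field,finite} \<Rightarrow> 'a) set"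
  assumes "L.subspace C"
  shows "card C = card (UNIV :: 'a set) ^ dim_L C"
proof -
  obtain B where B: "B \<subseteq> C" "L.independent B" "C \<subseteq> span_L B" "card B = dim_L C"
    by (rule L.basis_exists)
  have "span_L B = C" using L.span_subspace[OF B(1,3) assms] .
  then show ?thesis using card_span_L_independent[OF B(2)] unfolding B(4) by (simp only:)
qed

lemma in_span_sum_if_in_left: "x \<in> A \<Longrightarrow> x \<in> {a + b | a b. a \<in> span_L A \<and> b \<in> span_L B}"
  by (intro CollectI exI[of _ x] exI[of _ 0]) (simp add: L.span_base L.span_zero)

lemma Lnq_additive: "f \<in> Lnq q \<Longrightarrow> additive f"
  by (rule additive.intro) (simp add: Lnq_def)

lemma id_in_Lnq: "id \<in> Lnq q"
  by (simp add: Lnq_def)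

lemma inv_in_Lnq:
  assumes f: "f \<in> Lnq q" and "bij f"
  shows "inv f \<in> Lnq q"
proof -
  have inj: "inj f" and f_inv: "f (inv f y) = y" for y
    using \<open>bij f\<close> by (auto simp: bij_is_inj bij_is_surj surj_f_inv_f)
  have "inv f (x + y) = inv f x + inv f y" for x y
    using inj by (rule injD) (use f in \<open>simp add: Lnq_def f_inv\<close>)
  moreover have "inv f (c * x) = c * inv f x" if "c \<in> Fq q" for c x
    using inj by (rule injD) (use f that in \<open>simp add: Lnq_def f_inv\<close>)
  ultimately show ?thesis by (simp add: Lnq_def)
qed

lemma rk_comp_surj: "surj g \<Longrightarrow> rk q (f \<circ> g) = rk q f"
  unfolding rk_def by (metis image_comp)

lemma equivalent_codes_comp_right:
  assumes "g \<in> Lnq q" and "bij g"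
  shows "equivalent_codes q C ((\<lambda>f. f \<circ> g) ` C)"
  unfolding equivalent_codes_def
  by (intro exI[of _ id] exI[of _ g] exI[of _ id])
    (simp add: assms id_in_Lnq field_aut_def coeff_aut_def)

lemma equivalent_codes_comp:
  assumes "p \<in> Lnq q" and "bij p"
  shows "equivalent_codes q ((\<lambda>h. h \<circ> p) ` H) H"
proof -
  have "p \<circ> inv p = id" using bij_is_surj[OF assms(2)] surj_iff by blast
  then have "(\<lambda>f. f \<circ> inv p) ` (\<lambda>h. h \<circ> p) ` H = H"
    by (simp add: image_image o_assoc[symmetric])
  then show ?thesis
    using equivalent_codes_comp_right[OF inv_in_Lnq[OF assms] bij_imp_bij_inv[OF assms(2)]] by metis
qed

definition Fq_subspace :: "nat \<Rightarrow> 'a::field set \<Rightarrow> bool" where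
  "Fq_subspace q S \<longleftrightarrow> 0 \<in> S \<and> (\<forall>x\<in>S. \<forall>y\<in>S. x + y \<in> S) \<and> (\<forall>c\<in>Fq q. \<forall>x\<in>S. c * x \<in> S)"

definition Fq_independent :: "nat \<Rightarrow> 'a::field set \<Rightarrow> bool" where
  "Fq_independent q B \<longleftrightarrow>
     (\<forall>c. (\<forall>b\<in>B. c b \<in> Fq q) \<and> (\<Sum>b\<in>B. c b * b) = 0 \<longrightarrow> (\<forall>b\<in>B. c b = 0))"

lemma Fq_subspace_sum:
  assumes "Fq_subspace q S" and "\<And>i. i \<in> A \<Longrightarrow> f i \<in> S"
  shows "sum f A \<in> S"
  using assms(2)
  by (induction A rule: infinite_finite_induct) (use assms(1) in \<open>auto simp: Fq_subspace_def\<close>)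

lemma Fq_span_subset:
  assumes "Fq_subspace q S" and "B \<subseteq> S"
  shows "Fq_span q B \<subseteq> S"
proof
  fix x assume "x \<in> Fq_span q B"
  then obtain c where x: "x = (\<Sum>b\<in>B. c b * b)" and c: "\<forall>b\<in>B. c b \<in> Fq q"
    unfolding Fq_span_def by blast
  show "x \<in> S" unfolding x
    by (rule Fq_subspace_sum[OF assms(1)]) (use assms c in \<open>auto simp: Fq_subspace_def\<close>)
qed

lemma Lnq_vanishes_on_Fq_span:
  assumes h: "h \<in> Lnq q" and B: "\<forall>b\<in>B. h b = 0" and x: "x \<in> Fq_span q B"
  shows "h x = 0"
proof -
  interpret additive h by (rule Lnq_additive[OF h])
  obtain c where x: "x = (\<Sum>b\<in>B. c b * b)" and c: "\<forall>b\<in>B. c b \<in> Fq q"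
    using x unfolding Fq_span_def by blast
  have "h x = (\<Sum>b\<in>B. h (c b * b))" unfolding x by (rule sum)
  also have "\<dots> = (\<Sum>b\<in>B. c b * h b)" using h c by (intro sum.cong) (auto simp: Lnq_def)
  also have "\<dots> = 0" using B by simp
  finally show ?thesis .
qed

lemma Fq_subspace_range_Lnq:
  fixes h :: "'a::field \<Rightarrow> 'a"
  assumes h: "h \<in> Lnq q"
  shows "Fq_subspace q (range h)"
  unfolding Fq_subspace_def
proof (intro conjI ballI)
  interpret additive h by (rule Lnq_additive[OF h])
  show "0 \<in> range h" using zero by (metis rangeI)
  fix u v assume "u \<in> range h" "v \<in> range h"
  then obtain a b where "u = h a" "v = h b" by blast
  then show "u + v \<in> range h" by (simp flip: add)
next
  fix c u :: 'a assume "c \<in> Fq q" "u \<in> range h"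
  then obtain a where "c \<in> Fq q" "u = h a" by blast
  then have "c * u = h (c * a)" using h by (simp add: Lnq_def)
  then show "c * u \<in> range h" by simp
qed

section \<open>The field of order \<open>q\<^sup>n\<close>\<close>

locale Fqn_field =
  fixes q n :: nat
  assumes prime_power_q: "prime_power q" and n_pos: "0 < n"
    and card_field: "card (UNIV :: 'a::{field,finite} set) = q ^ n"
begin

lemma q_ge_2: "2 \<le> q"
proof -
  obtain P r where "prime P" "r > 0" "q = P ^ r" using prime_power_q unfolding prime_power_def by blast
  then show ?thesis using prime_ge_2_nat[of P] self_le_power[of P r] by simp
qed

lemma q_eq_CHAR_power: "\<exists>r. q = CHAR('a) ^ r"
proof -
  obtain P r where P: "prime P" "q = P ^ r" using prime_power_q unfolding prime_power_def by blast
  have CHAR: "prime CHAR('a)" by (simp add: finite_imp_CHAR_pos prime_CHAR_semidom)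
  have "CHAR('a) dvd P ^ (r * n)" using CHAR_dvd_card[where 'a='a] card_field P by (simp add: power_mult)
  then have "CHAR('a) dvd P" using CHAR prime_dvd_power by blast
  then have "CHAR('a) = P" using CHAR P(1) primes_dvd_imp_eq by blast
  then show ?thesis using P by blast
qed

lemma frobenius_add: "((x::'a) + y) ^ (q ^ j) = x ^ (q ^ j) + y ^ (q ^ j)"
proof -
  obtain r where r: "q = CHAR('a) ^ r" using q_eq_CHAR_power by blast
  show ?thesis
    by (rule freshmans_dream'[where n="r * j"])
      (auto simp: finite_imp_CHAR_pos prime_CHAR_semidom r power_mult)
qed

lemma frobenius_sum: "(sum (f :: 'b \<Rightarrow> 'a) A) ^ (q ^ j) = (\<Sum>i\<in>A. f i ^ (q ^ j))"
  by (induction A rule: infinite_finite_induct) (use q_ge_2 in \<open>simp_all add: frobenius_add\<close>)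

lemma frobenius_minus: "(- (x::'a)) ^ (q ^ j) = - (x ^ (q ^ j))"
proof -
  have "0 = (x + - x) ^ (q ^ j)" using q_ge_2 by simp
  also have "\<dots> = x ^ (q ^ j) + (- x) ^ (q ^ j)" by (rule frobenius_add)
  finally show ?thesis by (simp add: eq_neg_iff_add_eq_0 add.commute)
qed

lemma frobenius_diff: "((x::'a) - y) ^ (q ^ j) = x ^ (q ^ j) - y ^ (q ^ j)"
  using frobenius_add[of x "- y" j] frobenius_minus[of y j] by simp

lemma power_q_power_n: "(x::'a) ^ (q ^ n) = x"
  using finite_field_power_card[of x] card_field by simp

lemma power_q_power_mod: "(x::'a) ^ (q ^ m) = x ^ (q ^ (m mod n))"
proof -
  have "x ^ (q ^ m) = (x ^ (q ^ (n * (m div n)))) ^ (q ^ (m mod n))"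
    by (metis div_mult_mod_eq mult.commute power_add power_mult)
  then show ?thesis by (simp add: power_power_fixed_mult[OF power_q_power_n])
qed

lemma Fq_add: "x \<in> Fq q \<Longrightarrow> y \<in> Fq q \<Longrightarrow> (x::'a) + y \<in> Fq q"
  using frobenius_add[of x y 1] by (simp add: Fq_def)

lemma Fq_uminus: "x \<in> Fq q \<Longrightarrow> - (x::'a) \<in> Fq q"
  using frobenius_minus[of x 1] by (simp add: Fq_def)

lemma Fq_diff: "x \<in> Fq q \<Longrightarrow> y \<in> Fq q \<Longrightarrow> (x::'a) - y \<in> Fq q"
  using Fq_add Fq_uminus by (metis diff_conv_add_uminus)

lemma Fq_mult: "x \<in> Fq q \<Longrightarrow> y \<in> Fq q \<Longrightarrow> (x::'a) * y \<in> Fq q"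
  by (simp add: Fq_def power_mult_distrib)

lemma Fq_divide: "x \<in> Fq q \<Longrightarrow> y \<in> Fq q \<Longrightarrow> (x::'a) / y \<in> Fq q"
  by (simp add: Fq_def power_divide)

lemma zero_in_Fq: "(0::'a) \<in> Fq q"
  using q_ge_2 by (simp add: Fq_def)

lemma one_in_Fq: "(1::'a) \<in> Fq q"
  by (simp add: Fq_def)

lemma in_Fq_if_coprime_fixed:
  assumes "coprime t n" and "(x::'a) ^ (q ^ t) = x"
  shows "x \<in> Fq q"
proof (cases "t = 0")
  case True
  then have "n = 1" using assms(1) by simp
  then show ?thesis using power_q_power_n[of x] by (simp add: Fq_def)
next
  case False
  obtain u v where "t * u = n * v + gcd t n" using bezout_nat[OF False] by blast
  then have uv: "t * u = n * v + 1" using assms(1) by simp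
  have "x = x ^ (q ^ (t * u))" using power_power_fixed_mult[OF assms(2)] by simp
  also have "\<dots> = (x ^ (q ^ (n * v))) ^ q" by (simp only: uv power_add power_one_right power_mult)
  also have "\<dots> = x ^ q" by (simp add: power_power_fixed_mult[OF power_q_power_n])
  finally show ?thesis by (simp add: Fq_def)
qed

lemma card_Fq_le: "card (Fq q :: 'a set) \<le> q"
proof -
  define P :: "'a poly" where "P = monom 1 q + [:0, -1:]"
  have deg: "degree P = q" unfolding P_def
    using q_ge_2 by (subst degree_add_eq_left) (auto simp: degree_monom_eq)
  then have "P \<noteq> 0" using q_ge_2 by auto
  moreover have "{x. poly P x = 0} = Fq q"
    by (auto simp: P_def Fq_def poly_monom)
  ultimately show ?thesis using card_poly_roots_bound[of P] deg by simp
qed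

lemma trace_power_q: "(\<Sum>i<n. (x::'a) ^ (q ^ i)) ^ q = (\<Sum>i<n. x ^ (q ^ i))"
proof -
  have "(\<Sum>i<n. x ^ (q ^ i)) ^ q = (\<Sum>i<n. x ^ (q ^ Suc i))"
    using frobenius_sum[of "\<lambda>i. x ^ (q ^ i)" "{..<n}" 1]
    by (simp add: power_mult[symmetric] mult.commute)
  also have "\<dots> = (\<Sum>i<n. x ^ (q ^ i))"
    using n_pos power_q_power_n[of x] sum.lessThan_Suc_shift[of "\<lambda>i. x ^ (q ^ i)" n] by simp
  finally show ?thesis .
qed

lemma card_trace_kernel_le: "card {x::'a. (\<Sum>i<n. x ^ (q ^ i)) = 0} \<le> q ^ (n - 1)"
proof -
  define P :: "'a poly" where "P = (\<Sum>i<n. monom 1 (q ^ i))"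
  have "coeff P (q ^ (n - 1)) = (\<Sum>i<n. if q ^ i = q ^ (n - 1) then 1 else 0)"
    by (simp add: P_def coeff_sum)
  also have "\<dots> = (\<Sum>i\<in>{n - 1}. 1)"
    by (rule sum.mono_neutral_cong_right) (use n_pos q_ge_2 in \<open>auto simp: power_inject_exp\<close>)
  finally have "P \<noteq> 0" by auto
  moreover have "degree P \<le> q ^ (n - 1)" unfolding P_def
    by (rule degree_sum_le) (use q_ge_2 in \<open>auto simp: degree_monom_eq intro!: power_increasing\<close>)
  moreover have "{x. poly P x = 0} = {x. (\<Sum>i<n. x ^ (q ^ i)) = 0}"
    by (simp add: P_def poly_sum poly_monom)
  ultimately show ?thesis using card_poly_roots_bound[of P] by simp
qed

text \<open>The trace maps into \<open>F\<^sub>q\<close> and has at most \<open>q\<^sup>n\<^sup>-\<^sup>1\<close> roots, so its image has at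
  least \<open>q\<close> elements.\<close>

lemma card_Fq_ge: "q \<le> card (Fq q :: 'a set)"
proof -
  define T :: "'a \<Rightarrow> 'a" where "T x = (\<Sum>i<n. x ^ (q ^ i))" for x
  have T_additive: "additive T"
    by unfold_locales (simp add: T_def frobenius_add sum.distrib)
  have "range T \<subseteq> Fq q" using trace_power_q by (auto simp: T_def Fq_def)
  then have "card (range T) \<le> card (Fq q :: 'a set)" by (simp add: card_mono)
  moreover have "q \<le> card (range T)"
  proof (rule ccontr)
    assume "\<not> q \<le> card (range T)"
    then have "card (range T) * card {x. T x = 0} \<le> (q - 1) * q ^ (n - 1)"
      using card_trace_kernel_le by (intro mult_mono) (auto simp: T_def)
    also have "\<dots> < q ^ n" using q_ge_2 n_pos by (cases n) auto
    finally show False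
      using card_range_mult_card_kernel[OF T_additive] card_field by simp
  qed
  ultimately show ?thesis by simp
qed

lemma card_Fq: "card (Fq q :: 'a set) = q"
  using card_Fq_le card_Fq_ge by simp

lemma subset_Fq_span:
  assumes "finite (B :: 'a set)"
  shows "B \<subseteq> Fq_span q B"
proof
  fix x assume x: "x \<in> B"
  have "(\<Sum>b\<in>B. (if b = x then 1 else 0) * b) = x"
    using x assms by (simp add: if_distrib[of "\<lambda>c. c * _"] sum.delta cong: if_cong)
  moreover have "\<forall>b\<in>B. (if b = x then 1 else 0) \<in> (Fq q :: 'a set)"
    by (auto simp: zero_in_Fq one_in_Fq)
  ultimately show "x \<in> Fq_span q B" unfolding Fq_span_def
    by (auto intro!: exI[of _ "\<lambda>b. if b = x then 1 else 0"])
qed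

lemma Fq_subspace_Fq_span: "Fq_subspace q (Fq_span q (B :: 'a set))"
  unfolding Fq_subspace_def
proof (intro conjI ballI)
  show "0 \<in> Fq_span q B" unfolding Fq_span_def
    by (rule CollectI, rule exI[of _ "\<lambda>_. 0"]) (auto simp: zero_in_Fq)
next
  fix x y assume "x \<in> Fq_span q B" "y \<in> Fq_span q B"
  then obtain c d where "x = (\<Sum>b\<in>B. c b * b)" "\<forall>b\<in>B. c b \<in> Fq q"
    "y = (\<Sum>b\<in>B. d b * b)" "\<forall>b\<in>B. d b \<in> Fq q" unfolding Fq_span_def by blast
  then show "x + y \<in> Fq_span q B" unfolding Fq_span_def
    by (intro CollectI exI[of _ "\<lambda>b. c b + d b"]) (auto simp: Fq_add sum.distrib algebra_simps)
next
  fix a x :: 'a assume a: "a \<in> Fq q" and "x \<in> Fq_span q B"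
  then obtain c where "x = (\<Sum>b\<in>B. c b * b)" "\<forall>b\<in>B. c b \<in> Fq q" unfolding Fq_span_def by blast
  then show "a * x \<in> Fq_span q B" unfolding Fq_span_def using a
    by (intro CollectI exI[of _ "\<lambda>b. a * c b"]) (auto simp: Fq_mult sum_distrib_left mult.assoc)
qed

lemma card_Fq_span_independent:
  assumes "finite (B :: 'a set)" and "Fq_independent q B"
  shows "card (Fq_span q B) = q ^ card B"
proof -
  let ?comb = "\<lambda>c. \<Sum>b\<in>B. c b * b"
  have span_eq: "Fq_span q B = ?comb ` (PiE B (\<lambda>_. Fq q))"
  proof (intro equalityI subsetI)
    fix x assume "x \<in> Fq_span q B"
    then obtain c where x: "x = ?comb c" and c: "\<forall>b\<in>B. c b \<in> Fq q"
      unfolding Fq_span_def by blast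
    show "x \<in> ?comb ` (PiE B (\<lambda>_. Fq q))"
      by (rule image_eqI[of _ _ "restrict c B"]) (use c x in \<open>auto intro!: sum.cong simp: PiE_iff\<close>)
  qed (auto simp: Fq_span_def PiE_iff)
  have inj: "inj_on ?comb (PiE B (\<lambda>_. Fq q))"
  proof (rule inj_onI)
    fix c d assume c: "c \<in> PiE B (\<lambda>_. Fq q)" and d: "d \<in> PiE B (\<lambda>_. Fq q)"
      and cd: "?comb c = ?comb d"
    have "(\<Sum>b\<in>B. (c b - d b) * b) = 0" using cd by (simp add: algebra_simps sum_subtractf)
    moreover have "\<forall>b\<in>B. c b - d b \<in> Fq q" using c d by (auto simp: Fq_diff PiE_iff)
    ultimately have "\<forall>b\<in>B. c b - d b = 0"
      using spec[OF assms(2)[unfolded Fq_independent_def], of "\<lambda>b. c b - d b"] by blast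
    then show "c = d" using c d by (intro PiE_ext) auto
  qed
  show ?thesis unfolding span_eq using assms(1)
    by (simp add: card_image[OF inj] card_PiE card_Fq)
qed

lemma in_Fq_span_if_relation:
  assumes "\<forall>b\<in>B. c b \<in> Fq q" and "c b0 \<in> Fq q" and "c b0 \<noteq> 0"
    and "c b0 * b0 + (\<Sum>b\<in>B. c b * b) = (0::'a)"
  shows "b0 \<in> Fq_span q B"
proof -
  have "b0 = (- 1 / c b0) * (\<Sum>b\<in>B. c b * b)"
    using assms(3,4) by (simp add: field_simps eq_neg_iff_add_eq_0)
  also have "\<dots> = (\<Sum>b\<in>B. (- c b / c b0) * b)" by (simp add: sum_distrib_left)
  finally have "b0 = (\<Sum>b\<in>B. (- c b / c b0) * b)" .
  moreover have "\<forall>b\<in>B. - c b / c b0 \<in> Fq q" using assms(1,2) by (simp add: Fq_divide Fq_uminus)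
  ultimately show ?thesis unfolding Fq_span_def by (auto intro!: exI[of _ "\<lambda>b. - c b / c b0"])
qed

text \<open>A spanning set of minimal size, which exists by the definition of \<^const>\<open>Fq_dim\<close>,
  is independent.\<close>

lemma card_Fq_subspace:
  assumes S: "Fq_subspace q (S :: 'a set)"
  shows "card S = q ^ Fq_dim q S"
proof -
  define spans where "spans r \<longleftrightarrow> (\<exists>B. finite B \<and> card B = r \<and> B \<subseteq> S \<and> Fq_span q B = S)" for r
  have "spans (card S)" unfolding spans_def
    by (intro exI[of _ S]) (use Fq_span_subset[OF S] subset_Fq_span[of S] in auto)
  then have "spans (Fq_dim q S)" unfolding Fq_dim_def spans_def by (rule LeastI)
  then obtain B where B: "finite B" "card B = Fq_dim q S" "B \<subseteq> S" "Fq_span q B = S"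
    unfolding spans_def by blast
  have minimal: "\<not> spans r" if "r < Fq_dim q S" for r
    using not_less_Least[OF that[unfolded Fq_dim_def]] unfolding spans_def by blast
  have "Fq_independent q B"
  proof (rule ccontr)
    assume "\<not> Fq_independent q B"
    then obtain c b0 where c: "\<forall>b\<in>B. c b \<in> Fq q" "(\<Sum>b\<in>B. c b * b) = 0" "b0 \<in> B" "c b0 \<noteq> 0"
      unfolding Fq_independent_def by blast
    define B' where "B' = B - {b0}"
    have "c b0 * b0 + (\<Sum>b\<in>B'. c b * b) = 0"
      using c B(1) unfolding B'_def by (simp add: sum.remove)
    then have "b0 \<in> Fq_span q B'"
      by (intro in_Fq_span_if_relation) (use c in \<open>auto simp: B'_def\<close>)
    then have "B \<subseteq> Fq_span q B'" using subset_Fq_span[of B'] B(1) by (auto simp: B'_def)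
    then have "Fq_span q B' = S"
      using Fq_span_subset[OF Fq_subspace_Fq_span, of B B'] Fq_span_subset[OF S, of B'] B(3,4)
      by (auto simp: B'_def)
    moreover have "finite B'" "B' \<subseteq> S" using B(1,3) by (auto simp: B'_def)
    ultimately have "spans (card B')" unfolding spans_def by blast
    moreover have "card B' < card B" using B(1) c(3) unfolding B'_def by (rule card_Diff1_less)
    ultimately show False using minimal[of "card B'"] B(2) by simp
  qed
  then show ?thesis using card_Fq_span_independent[OF B(1)] B by simp
qed

lemma exists_Fq_independent:
  "m \<le> n \<Longrightarrow> \<exists>B :: 'a set. finite B \<and> card B = m \<and> Fq_independent q B"
proof (induction m)
  case 0
  show ?case by (intro exI[of _ "{}"]) (auto simp: Fq_independent_def)
next
  case (Suc m)
  then obtain B :: "'a set" where B: "finite B" "card B = m" "Fq_independent q B" by auto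
  have "card (Fq_span q B) < card (UNIV :: 'a set)"
    using card_Fq_span_independent[OF B(1,3)] B(2) Suc(2) card_field q_ge_2
    by (simp add: power_strict_increasing_iff)
  then have "Fq_span q B \<noteq> UNIV" by auto
  then obtain x where x: "x \<notin> Fq_span q B" by blast
  have xB: "x \<notin> B" using x subset_Fq_span[OF B(1)] by blast
  have "Fq_independent q (insert x B)" unfolding Fq_independent_def
  proof (intro allI impI ballI)
    fix c b assume c: "(\<forall>b\<in>insert x B. c b \<in> Fq q) \<and> (\<Sum>b\<in>insert x B. c b * b) = 0"
      and b: "b \<in> insert x B"
    have relation: "c x * x + (\<Sum>b\<in>B. c b * b) = 0" using c B(1) xB by simp
    have "c x = 0" using x c in_Fq_span_if_relation[OF _ _ _ relation] by auto
    then have "\<forall>b\<in>B. c b = 0" using relation c B(3) unfolding Fq_independent_def by auto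
    then show "c b = 0" using \<open>c x = 0\<close> b by auto
  qed
  then show ?case using B xB by (intro exI[of _ "insert x B"]) auto
qed

section \<open>Rank and the Singleton bound\<close>

lemma card_range_Lnq: "h \<in> Lnq q \<Longrightarrow> card (range (h :: 'a \<Rightarrow> 'a)) = q ^ rk q h"
  unfolding rk_def by (rule card_Fq_subspace[OF Fq_subspace_range_Lnq])

lemma rk_le:
  assumes h: "h \<in> Lnq q"
  shows "rk q (h :: 'a \<Rightarrow> 'a) \<le> n"
proof -
  have "q ^ rk q h \<le> q ^ n"
    using card_mono[of UNIV "range h"] card_range_Lnq[OF h] card_field by simp
  then show ?thesis using q_ge_2 by (simp add: power_le_imp_le_exp)
qed

lemma card_kernel_Lnq:
  assumes h: "h \<in> Lnq q"
  shows "card {x. (h :: 'a \<Rightarrow> 'a) x = 0} = q ^ (n - rk q h)"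
proof -
  have "q ^ rk q h * card {x. h x = 0} = q ^ n"
    using card_range_mult_card_kernel[OF Lnq_additive[OF h]] card_range_Lnq[OF h] card_field
    by simp
  also have "\<dots> = q ^ rk q h * q ^ (n - rk q h)"
    using rk_le[OF h] by (simp flip: power_add)
  finally show ?thesis using q_ge_2 by simp
qed

lemma rank_ge_if_card_kernel_le:
  assumes "h \<in> Lnq q" and "card {x. (h :: 'a \<Rightarrow> 'a) x = 0} \<le> q ^ m"
  shows "n - m \<le> rk q h"
  using assms q_ge_2 by (simp add: card_kernel_Lnq power_le_imp_le_exp)

lemma rank_le_if_card_kernel_ge:
  assumes "h \<in> Lnq q" and "q ^ m \<le> card {x. (h :: 'a \<Rightarrow> 'a) x = 0}"
  shows "rk q h \<le> n - m"
  using assms q_ge_2 rk_le[OF assms(1)] by (simp add: card_kernel_Lnq power_le_imp_le_exp)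

lemma card_kernel_Lnq_le_pred:
  assumes "h \<in> Lnq q" and "card {x. (h :: 'a \<Rightarrow> 'a) x = 0} < q ^ m"
  shows "card {x. h x = 0} \<le> q ^ (m - 1)"
  using assms q_ge_2 by (simp add: card_kernel_Lnq power_strict_increasing_iff)

text \<open>Two codewords that agree on an \<open>m\<close>-dimensional \<open>F\<^sub>q\<close>-subspace differ by a codeword
  with a large kernel.\<close>

lemma exists_low_rank_element:
  fixes C :: "('a \<Rightarrow> 'a) set"
  assumes "C \<subseteq> Lnq q" and "L.subspace C" and "m \<le> n" and "q ^ (n * m) < card C"
  shows "\<exists>h\<in>C. h \<noteq> 0 \<and> rk q h \<le> n - m"
proof -
  obtain B :: "'a set" where B: "finite B" "card B = m" "Fq_independent q B"
    using exists_Fq_independent[OF assms(3)] by blast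
  have "\<not> inj_on (\<lambda>h. restrict h B) C"
  proof
    assume "inj_on (\<lambda>h. restrict h B) C"
    then have "card C \<le> card (PiE B (\<lambda>_. UNIV :: 'a set))"
      by (rule card_inj_on_le) (auto intro: finite_PiE B(1))
    also have "\<dots> = q ^ (n * m)" using B card_field by (simp add: card_PiE power_mult)
    finally show False using assms(4) by simp
  qed
  then obtain h1 h2 where h12: "h1 \<in> C" "h2 \<in> C" "h1 \<noteq> h2" "restrict h1 B = restrict h2 B"
    unfolding inj_on_def by blast
  define h where "h = h1 - h2"
  have "h \<in> C" unfolding h_def by (rule L.subspace_diff[OF assms(2) h12(1,2)])
  then have h: "h \<in> Lnq q" using assms(1) by blast
  have "\<forall>b\<in>B. h b = 0"
    using h12(4) by (auto simp: h_def fun_eq_iff restrict_def split: if_splits)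
  then have "Fq_span q B \<subseteq> {x. h x = 0}"
    using Lnq_vanishes_on_Fq_span[OF h] by blast
  then have "card (Fq_span q B) \<le> card {x. h x = 0}" by (intro card_mono) auto
  then have "q ^ m \<le> card {x. h x = 0}" using card_Fq_span_independent[OF B(1,3)] B(2) by simp
  then have "rk q h \<le> n - m" by (rule rank_le_if_card_kernel_ge[OF h])
  moreover have "h \<noteq> 0" using h12(3) by (simp add: h_def)
  ultimately show ?thesis using \<open>h \<in> C\<close> by blast
qed

lemma dim_lt_if_inter_U1:
  fixes C :: "('a \<Rightarrow> 'a) set"
  assumes C: "C \<subseteq> Lnq q" "L.subspace C" and U1: "C \<inter> U1 q = {0}"
  shows "dim_L C < n"
proof (rule ccontr)
  assume "\<not> dim_L C < n"
  then have "n * (n - 1) < n * dim_L C" using n_pos by simp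
  then have "q ^ (n * (n - 1)) < card C"
    using card_subspace_L[OF C(2)] card_field q_ge_2 by (simp add: power_mult[symmetric])
  then obtain h where "h \<in> C" "h \<noteq> 0" "rk q h \<le> n - (n - 1)"
    using exists_low_rank_element[OF C, of "n - 1"] by auto
  then have "h \<in> C \<inter> U1 q" using C(1) n_pos by (auto simp: U1_def)
  then show False using U1 \<open>h \<noteq> 0\<close> by blast
qed

lemma MRD_if_rank_ge:
  fixes C :: "('a \<Rightarrow> 'a) set"
  assumes C: "C \<subseteq> Lnq q" "L.subspace C" and k: "dim_L C = k" "0 < k" "k \<le> n"
    and rank: "\<And>f. f \<in> C \<Longrightarrow> f \<noteq> 0 \<Longrightarrow> n - k + 1 \<le> rk q f"
  shows "MRD q n C"
proof -
  have card_C: "card C = q ^ (n * k)"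
    using card_subspace_L[OF C(2)] card_field k(1) by (simp add: power_mult)
  let ?D = "{rk q (f - g) | f g. f \<in> C \<and> g \<in> C \<and> f \<noteq> g}"
  have "min_dist q C = n - k + 1"
    unfolding min_dist_def
  proof (rule Min_eqI)
    show "finite ?D"
      by (rule finite_subset[of _ "(\<lambda>(f, g). rk q (f - g)) ` (C \<times> C)"]) auto
  next
    fix d assume "d \<in> ?D"
    then obtain f g where "d = rk q (f - g)" "f \<in> C" "g \<in> C" "f \<noteq> g" by blast
    then show "n - k + 1 \<le> d" using rank L.subspace_diff[OF C(2)] by simp
  next
    have "q ^ (n * (k - 1)) < card C"
      using card_C q_ge_2 n_pos k(2) by (simp add: power_strict_increasing_iff)
    moreover have "k - 1 \<le> n" using k by simp
    ultimately obtain h where "h \<in> C" "h \<noteq> 0" "rk q h \<le> n - (k - 1)"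
      using exists_low_rank_element[OF C] by blast
    moreover have "0 \<in> C" by (rule L.subspace_0[OF C(2)])
    ultimately show "n - k + 1 \<in> ?D"
      using rank[of h] k by (intro CollectI exI[of _ h] exI[of _ 0]) auto
  qed
  moreover have "n - (n - k + 1) + 1 = k" using k by simp
  ultimately show ?thesis unfolding MRD_def card_C by simp
qed

end

section \<open>Kernels of \<open>\<sigma>\<close>-polynomials\<close>

definition sigma_poly :: "nat \<Rightarrow> nat \<Rightarrow> (nat \<Rightarrow> 'a::field) \<Rightarrow> nat \<Rightarrow> 'a \<Rightarrow> 'a" where
  "sigma_poly q t a k x = (\<Sum>i\<le>k. a i * x ^ (q ^ (t * i)))"

lemma sigma_poly_0: "sigma_poly q t a 0 x = a 0 * x"
  by (simp add: sigma_poly_def)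

lemma sigma_poly_Suc:
  "sigma_poly q t a (Suc k) x = sigma_poly q t a k x + a (Suc k) * x ^ (q ^ (t * Suc k))"
  by (simp add: sigma_poly_def)

lemma sigma_poly_cong: "(\<And>i. i \<le> k \<Longrightarrow> a i = b i) \<Longrightarrow> sigma_poly q t a k x = sigma_poly q t b k x"
  by (simp add: sigma_poly_def)

lemma normq_mult: "normq q n (x * y) = normq q n x * normq q n y"
  by (simp add: normq_def power_mult_distrib prod.distrib)

lemma normq_power: "normq q n (x ^ m) = normq q n x ^ m"
  by (simp add: normq_def prod_power_distrib power_mult[symmetric] mult.commute)

lemma normq_nonzero: "x \<noteq> 0 \<Longrightarrow> normq q n x \<noteq> 0"
  by (simp add: normq_def)

lemma minus_one_power_mult_eq_1_iff: "(- 1) ^ m * x = (1::'a::comm_ring_1) \<longleftrightarrow> x = (- 1) ^ m"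
proof
  assume "(- 1) ^ m * x = 1"
  then have "(- 1) ^ m * ((- 1) ^ m * x) = (- 1) ^ m" by (simp only: mult_1_right)
  then show "x = (- 1) ^ m" by simp
qed simp

context Fqn_field
begin

lemma normq_power_q: "normq q n (x::'a) ^ q = normq q n x"
proof (cases "x = 0")
  case True
  have "normq q n (0::'a) = 0" using n_pos q_ge_2 by (simp add: normq_def power_0_left)
  then show ?thesis using True q_ge_2 by simp
next
  case False
  have "normq q n x ^ q * x = (\<Prod>i<n. x ^ (q ^ Suc i)) * x"
    by (simp add: normq_def prod_power_distrib power_mult[symmetric] mult.commute)
  also have "\<dots> = (\<Prod>i<Suc n. x ^ (q ^ i))"
    by (subst prod.lessThan_Suc_shift) (simp add: mult.commute)
  also have "\<dots> = normq q n x * x"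
    using power_q_power_n[of x] by (simp add: normq_def)
  finally show ?thesis using False by simp
qed

lemma normq_frobenius: "normq q n ((x::'a) ^ (q ^ j)) = normq q n x"
  using power_power_fixed_mult[of "normq q n x" q 1 j] normq_power_q by (simp add: normq_power)

lemma normq_uminus: "normq q n (- x :: 'a) = (- 1) ^ n * normq q n x"
proof -
  have "normq q n (- 1 :: 'a) = (- 1) ^ n" using frobenius_minus[of 1] by (simp add: normq_def)
  then show ?thesis using normq_mult[of q n "- 1" x] by simp
qed

lemma normq_eq_1_if_ratio:
  assumes "(u::'a) \<noteq> 0" and "c * u = u ^ (q ^ t)"
  shows "normq q n c = 1"
proof -
  have "normq q n c * normq q n u = normq q n u"
    using normq_mult[of q n c u] assms(2) normq_frobenius[of u t] by simp
  then show ?thesis using normq_nonzero[OF assms(1)] by simp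
qed

lemma sigma_poly_additive: "additive (sigma_poly q t (a :: nat \<Rightarrow> 'a) k)"
  by unfold_locales (simp add: sigma_poly_def frobenius_add distrib_left sum.distrib)

lemma sigma_poly_in_Lnq: "sigma_poly q t (a :: nat \<Rightarrow> 'a) k \<in> Lnq q"
proof -
  have "sigma_poly q t a k (c * x) = c * sigma_poly q t a k x" if "c \<in> Fq q" for c x :: 'a
  proof -
    have "c ^ (q ^ (t * i)) = c" for i
      using power_power_fixed_mult[of c q 1 "t * i"] that by (simp add: Fq_def)
    then show ?thesis
      by (simp add: sigma_poly_def power_mult_distrib sum_distrib_left algebra_simps)
  qed
  then show ?thesis
    using additive.add[OF sigma_poly_additive] by (simp add: Lnq_def)
qed

lemma sigma_poly_right_division:
  "\<exists>b. (\<forall>x::'a. sigma_poly q t a (Suc k) x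
          = sigma_poly q t b k (x ^ (q ^ t) - c * x) + (a 0 + b 0 * c) * x)
       \<and> b k = a (Suc k)"
proof (induction k arbitrary: a)
  case 0
  show ?case
    by (intro exI[of _ "\<lambda>_. a 1"]) (simp add: sigma_poly_def algebra_simps)
next
  case (Suc k)
  define a' where "a' = a(Suc k := a (Suc k) + a (Suc (Suc k)) * c ^ (q ^ (t * Suc k)))"
  obtain b' where b': "\<And>x::'a. sigma_poly q t a' (Suc k) x
      = sigma_poly q t b' k (x ^ (q ^ t) - c * x) + (a' 0 + b' 0 * c) * x"
    using Suc.IH[of a'] by blast
  define b where "b = b'(Suc k := a (Suc (Suc k)))"
  have "(x ^ (q ^ t)) ^ (q ^ (t * Suc k)) = x ^ (q ^ (t * Suc (Suc k)))" for x :: 'a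
    by (simp flip: power_mult power_add)
  then have frob: "(x ^ (q ^ t) - c * x) ^ (q ^ (t * Suc k))
      = x ^ (q ^ (t * Suc (Suc k))) - c ^ (q ^ (t * Suc k)) * x ^ (q ^ (t * Suc k))" for x :: 'a
    by (simp only: frobenius_diff power_mult_distrib)
  have "sigma_poly q t a (Suc (Suc k)) x = sigma_poly q t a' (Suc k) x
      + a (Suc (Suc k)) * (x ^ (q ^ t) - c * x) ^ (q ^ (t * Suc k))" for x :: 'a
    unfolding frob using sigma_poly_cong[of k a' a q t x]
    by (simp add: sigma_poly_Suc a'_def algebra_simps)
  moreover have "sigma_poly q t b (Suc k) y
      = sigma_poly q t b' k y + a (Suc (Suc k)) * y ^ (q ^ (t * Suc k))" for y :: 'a
    using sigma_poly_cong[of k b b' q t y] by (simp add: sigma_poly_Suc b_def)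
  moreover have "a' 0 = a 0" "b 0 = b' 0" by (simp_all add: a'_def b_def)
  ultimately have "sigma_poly q t a (Suc (Suc k)) x
      = sigma_poly q t b (Suc k) (x ^ (q ^ t) - c * x) + (a 0 + b 0 * c) * x" for x :: 'a
    using b' by (simp add: algebra_simps)
  moreover have "b (Suc k) = a (Suc (Suc k))" by (simp add: b_def)
  ultimately show ?case by blast
qed

lemma card_kernel_frobenius_minus_le:
  assumes "coprime t n" and "(u::'a) \<noteq> 0" and cu: "c * u = u ^ (q ^ t)"
  shows "card {x::'a. x ^ (q ^ t) - c * x = 0} \<le> q"
proof -
  have "c \<noteq> 0" using assms(2) cu by auto
  have "{x. x ^ (q ^ t) - c * x = 0} \<subseteq> (\<lambda>y. y * u) ` Fq q"
  proof
    fix x assume "x \<in> {x. x ^ (q ^ t) - c * x = 0}"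
    then have "(x / u) ^ (q ^ t) = x / u"
      using \<open>c \<noteq> 0\<close> by (simp add: power_divide cu[symmetric])
    then have "x / u \<in> Fq q" by (rule in_Fq_if_coprime_fixed[OF assms(1)])
    then show "x \<in> (\<lambda>y. y * u) ` Fq q" using assms(2) by (intro image_eqI[of _ _ "x / u"]) auto
  qed
  then have "card {x. x ^ (q ^ t) - c * x = 0} \<le> card ((\<lambda>y. y * u) ` (Fq q :: 'a set))"
    by (intro card_mono) auto
  also have "\<dots> \<le> q" using card_image_le[of "Fq q" "\<lambda>y. y * u"] card_Fq by simp
  finally show ?thesis .
qed

lemma sigma_poly_root_division:
  assumes "(u::'a) \<noteq> 0" and "c * u = u ^ (q ^ t)" and "sigma_poly q t a (Suc k) u = 0"
  obtains b where "\<And>x::'a. sigma_poly q t a (Suc k) x = sigma_poly q t b k (x ^ (q ^ t) - c * x)"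
    and "b k = a (Suc k)" and "a 0 = - (b 0 * c)"
proof -
  obtain b where b: "\<And>x::'a. sigma_poly q t a (Suc k) x
      = sigma_poly q t b k (x ^ (q ^ t) - c * x) + (a 0 + b 0 * c) * x" "b k = a (Suc k)"
    using sigma_poly_right_division[of t a k c] by blast
  have "(a 0 + b 0 * c) * u = 0"
    using b(1)[of u] assms additive.zero[OF sigma_poly_additive] by simp
  then have "a 0 + b 0 * c = 0" using assms(1) by simp
  then show ?thesis using that[of b] b by (simp add: eq_neg_iff_add_eq_0)
qed

lemma card_sigma_poly_kernel_le_factor:
  assumes "coprime t n" and "(u::'a) \<noteq> 0" and "c * u = u ^ (q ^ t)"
    and factor: "\<And>x. sigma_poly q t a (Suc k) x = sigma_poly q t b k (x ^ (q ^ t) - c * x)"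
  shows "card {x::'a. sigma_poly q t a (Suc k) x = 0} \<le> q * card {y. sigma_poly q t b k y = 0}"
proof -
  define D where "D x = x ^ (q ^ t) - c * x" for x :: 'a
  have "additive D"
    by unfold_locales (simp add: D_def frobenius_add algebra_simps)
  then have "card {x. sigma_poly q t a (Suc k) x = 0}
      \<le> card {x. D x = 0} * card (D ` {x. sigma_poly q t a (Suc k) x = 0})"
    by (rule card_le_card_kernel_mult_card_image)
  also have "\<dots> \<le> q * card {y. sigma_poly q t b k y = 0}"
    using card_kernel_frobenius_minus_le[OF assms(1-3), folded D_def] factor
    by (intro mult_mono card_mono) (auto simp: D_def)
  finally show ?thesis .
qed

text \<open>Induction on \<open>k\<close>: a nonzero root \<open>u\<close> splits off the right factor \<open>x\<^sup>\<sigma> - c x\<close> with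
  \<open>c = u\<^sup>\<sigma>/u\<close>, whose kernel \<open>u F\<^sub>q\<close> has \<open>q\<close> elements, and \<open>N(c) = 1\<close>.\<close>

lemma card_sigma_poly_kernel:
  assumes cop: "coprime t n" and top: "a k \<noteq> 0"
  shows "card {x::'a. sigma_poly q t a k x = 0} \<le> q ^ k \<and>
    (card {x::'a. sigma_poly q t a k x = 0} = q ^ k
      \<longrightarrow> normq q n (a 0) = (- 1) ^ (n * k) * normq q n (a k))"
  using top
proof (induction k arbitrary: a)
  case 0
  then have "{x::'a. sigma_poly q t a 0 x = 0} = {0}" by (auto simp: sigma_poly_0)
  then show ?case by simp
next
  case (Suc k)
  let ?K = "{x::'a. sigma_poly q t a (Suc k) x = 0}"
  show ?case
  proof (cases "\<exists>u::'a. u \<noteq> 0 \<and> sigma_poly q t a (Suc k) u = 0")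
    case False
    then have "?K \<subseteq> {0}" by auto
    then have "card ?K \<le> 1" using card_mono[of "{0}" ?K] by simp
    moreover have "1 < q ^ Suc k" using q_ge_2 one_less_power[of q "Suc k"] by linarith
    ultimately show ?thesis by simp
  next
    case True
    then obtain u :: 'a where u: "u \<noteq> 0" "sigma_poly q t a (Suc k) u = 0" by blast
    define c where "c = u ^ (q ^ t) / u"
    have cu: "c * u = u ^ (q ^ t)" using u by (simp add: c_def)
    obtain b where b: "\<And>x. sigma_poly q t a (Suc k) x = sigma_poly q t b k (x ^ (q ^ t) - c * x)"
      "b k = a (Suc k)" "a 0 = - (b 0 * c)"
      using sigma_poly_root_division[OF u(1) cu u(2)] by blast
    let ?G = "{y::'a. sigma_poly q t b k y = 0}"
    have K_le: "card ?K \<le> q * card ?G"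
      by (rule card_sigma_poly_kernel_le_factor[OF cop u(1) cu b(1)])
    have IH: "card ?G \<le> q ^ k"
      "card ?G = q ^ k \<Longrightarrow> normq q n (b 0) = (- 1) ^ (n * k) * normq q n (b k)"
      using Suc.IH[of b] b(2) Suc.prems by auto
    have "card ?K \<le> q * q ^ k" using K_le mult_le_mono2[OF IH(1), of q] by (rule le_trans)
    then have "card ?K \<le> q ^ Suc k" by simp
    moreover have "normq q n (a 0) = (- 1) ^ (n * Suc k) * normq q n (a (Suc k))"
      if "card ?K = q ^ Suc k"
    proof -
      have "q ^ k \<le> card ?G" using K_le that q_ge_2 by simp
      then have "normq q n (b 0) = (- 1) ^ (n * k) * normq q n (a (Suc k))"
        using IH b(2) by simp
      moreover have "normq q n c = 1" by (rule normq_eq_1_if_ratio[OF u(1) cu])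
      ultimately show ?thesis using b(3) by (simp add: normq_mult normq_uminus power_add)
    qed
    ultimately show ?thesis by blast
  qed
qed

lemma card_sigma_poly_kernel_le:
  assumes "coprime t n" and "\<exists>i\<le>k. a i \<noteq> 0"
  shows "card {x::'a. sigma_poly q t a k x = 0} \<le> q ^ k"
  using assms(2)
proof (induction k)
  case 0
  then show ?case using card_sigma_poly_kernel[OF assms(1), of a 0] by auto
next
  case (Suc k)
  show ?case
  proof (cases "a (Suc k) = 0")
    case True
    then have "\<exists>i\<le>k. a i \<noteq> 0" using Suc.prems le_Suc_eq by blast
    have "card {x::'a. sigma_poly q t a (Suc k) x = 0} = card {x. sigma_poly q t a k x = 0}"
      using True by (simp add: sigma_poly_Suc)
    also have "\<dots> \<le> q ^ k" by (rule Suc.IH) fact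
    also have "\<dots> \<le> q ^ Suc k" using q_ge_2 by simp
    finally show ?thesis .
  next
    case False
    then show ?thesis using card_sigma_poly_kernel[OF assms(1), of a "Suc k"] by blast
  qed
qed

end

section \<open>The codes \<open>H\<^sub>k\<^sub>,\<^sub>s(\<eta>)\<close>\<close>

definition H_poly :: "nat \<Rightarrow> nat \<Rightarrow> nat \<Rightarrow> int \<Rightarrow> 'a::field \<Rightarrow> (nat \<Rightarrow> 'a) \<Rightarrow> 'a \<Rightarrow> 'a" where
  "H_poly q n k s \<eta> a = scl (a 0) (\<lambda>x. x + \<eta> * xq q n (s * int k) x)
     + (\<Sum>i\<in>{1..<k}. scl (a i) (xq q n (s * int i)))"

lemma H_poly_apply:
  "H_poly q n k s \<eta> a x = a 0 * (x + \<eta> * xq q n (s * int k) x) + (\<Sum>i\<in>{1..<k}. a i * xq q n (s * int i) x)"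
  by (simp add: H_poly_def scl_def sum_fun_apply)

lemma L_subspace_range_H_poly: "L.subspace (range (H_poly q n k s \<eta>))"
proof (rule L.subspaceI)
  have "H_poly q n k s \<eta> (\<lambda>_. 0) = 0" by (simp add: fun_eq_iff H_poly_apply)
  then show "0 \<in> range (H_poly q n k s \<eta>)" by (metis rangeI)
next
  fix f g assume "f \<in> range (H_poly q n k s \<eta>)" "g \<in> range (H_poly q n k s \<eta>)"
  then obtain a b where "f = H_poly q n k s \<eta> a" "g = H_poly q n k s \<eta> b" by blast
  then have "f + g = H_poly q n k s \<eta> (\<lambda>i. a i + b i)"
    by (simp add: fun_eq_iff H_poly_apply algebra_simps sum.distrib)
  then show "f + g \<in> range (H_poly q n k s \<eta>)" by simp
next
  fix c f assume "f \<in> range (H_poly q n k s \<eta>)"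
  then obtain a where "f = H_poly q n k s \<eta> a" by blast
  then have "scl c f = H_poly q n k s \<eta> (\<lambda>i. c * a i)"
    by (simp add: fun_eq_iff H_poly_apply scl_def algebra_simps sum_distrib_left)
  then show "scl c f \<in> range (H_poly q n k s \<eta>)" by simp
qed

lemma H_code_eq_range_H_poly: "H_code q n k s \<eta> = range (H_poly q n k s \<eta>)"
proof -
  define G where "G = insert (\<lambda>x. x + \<eta> * xq q n (s * int k) x) {xq q n (s * int i) | i. 1 \<le> i \<and> i \<le> k - 1}"
  have "H_poly q n k s \<eta> a \<in> span_L G" for a
    unfolding H_poly_def G_def by (intro L.span_add L.span_scale L.span_sum L.span_base) auto
  moreover have "G \<subseteq> range (H_poly q n k s \<eta>)"
  proof
    fix g assume "g \<in> G"
    then consider "g = (\<lambda>x. x + \<eta> * xq q n (s * int k) x)"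
      | i where "g = xq q n (s * int i)" "i \<in> {1..<k}"
      unfolding G_def by fastforce
    then show "g \<in> range (H_poly q n k s \<eta>)"
    proof cases
      case 1
      then have "H_poly q n k s \<eta> (\<lambda>j. if j = 0 then 1 else 0) = g"
        by (simp add: fun_eq_iff H_poly_apply)
      then show ?thesis by (metis rangeI)
    next
      case (2 i)
      then have "H_poly q n k s \<eta> (\<lambda>j. if j = i then 1 else 0) = g"
        by (simp add: fun_eq_iff H_poly_apply if_distrib[of "\<lambda>c. c * _"] sum.delta cong: if_cong)
      then show ?thesis by (metis rangeI)
    qed
  qed
  then have "span_L G \<subseteq> range (H_poly q n k s \<eta>)"
    by (rule L.span_minimal[OF _ L_subspace_range_H_poly])
  ultimately show ?thesis unfolding H_code_def G_def by blast
qed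

lemma H_code_comp_eq_code:
  fixes C :: "('a::{field,finite} \<Rightarrow> 'a) set"
  assumes C: "L.subspace C" and "surj p"
    and twists: "\<And>i. 1 \<le> i \<Longrightarrow> i < k \<Longrightarrow> twist q n (s * int i) p \<in> C"
    and eta_C: "p + scl \<eta> (twist q n (s * int k) p) \<in> C"
    and card: "card (H_code q n k s \<eta>) = card C"
  shows "(\<lambda>h. h \<circ> p) ` H_code q n k s \<eta> = C"
proof (rule card_subset_eq)
  show "(\<lambda>h. h \<circ> p) ` H_code q n k s \<eta> \<subseteq> C"
  proof (clarsimp simp: H_code_eq_range_H_poly)
    fix a
    have "H_poly q n k s \<eta> a \<circ> p = scl (a 0) (p + scl \<eta> (twist q n (s * int k) p))
        + (\<Sum>i\<in>{1..<k}. scl (a i) (twist q n (s * int i) p))"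
      by (simp add: fun_eq_iff H_poly_apply scl_def sum_fun_apply twist_def algebra_simps)
    also have "\<dots> \<in> C"
      using twists by (intro L.subspace_add[OF C] L.subspace_scale[OF C] L.subspace_sum[OF C] eta_C) auto
    finally show "H_poly q n k s \<eta> a \<circ> p \<in> C" .
  qed
  have "inj (\<lambda>h. h \<circ> p)"
  proof (rule injI)
    fix h1 h2 assume eq: "h1 \<circ> p = h2 \<circ> p"
    show "h1 = h2"
    proof
      fix y
      obtain x where "y = p x" using \<open>surj p\<close> by (metis surjD)
      then show "h1 y = h2 y" using eq by (metis comp_apply)
    qed
  qed
  then have "inj_on (\<lambda>h. h \<circ> p) (H_code q n k s \<eta>)" by (rule inj_on_subset) simp
  then show "card ((\<lambda>h. h \<circ> p) ` H_code q n k s \<eta>) = card C"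
    using card by (simp add: card_image)
qed simp

context Fqn_field
begin

lemma coprime_nat_mod:
  assumes "gcd s (int n) = 1"
  shows "coprime (nat (s mod int n)) n"
proof -
  have "gcd (s mod int n) (int n) = 1" using assms by (metis gcd.commute gcd_red_int)
  then show ?thesis using n_pos by (simp add: coprime_iff_gcd_eq_1 gcd_int_def)
qed

lemma xq_eq_power: "xq q n (s * int i) (x::'a) = x ^ (q ^ (nat (s mod int n) * i))"
proof -
  have "s mod int n = int (nat (s mod int n))" using n_pos by simp
  then have "(s * int i) mod int n = int ((nat (s mod int n) * i) mod n)"
    by (metis mod_mult_left_eq of_nat_mod of_nat_mult)
  then have "nat ((s * int i) mod int n) = (nat (s mod int n) * i) mod n" by simp
  then show ?thesis unfolding xq_def using power_q_power_mod by simp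
qed

lemma H_poly_eq_sigma_poly:
  assumes "0 < k"
  shows "H_poly q n k s \<eta> (a :: nat \<Rightarrow> 'a) = sigma_poly q (nat (s mod int n)) (a(k := \<eta> * a 0)) k"
proof
  fix x
  let ?t = "nat (s mod int n)"
  have "{..k} = insert 0 (insert k {1..<k})" using assms by auto
  then have "sigma_poly q ?t (a(k := \<eta> * a 0)) k x
      = a 0 * x + (\<eta> * a 0 * x ^ (q ^ (?t * k)) + (\<Sum>i\<in>{1..<k}. a i * x ^ (q ^ (?t * i))))"
    using assms by (simp add: sigma_poly_def)
  then show "H_poly q n k s \<eta> a x = sigma_poly q ?t (a(k := \<eta> * a 0)) k x"
    by (simp add: H_poly_apply xq_eq_power algebra_simps)
qed

lemma H_poly_in_Lnq: "0 < k \<Longrightarrow> H_poly q n k s \<eta> (a :: nat \<Rightarrow> 'a) \<in> Lnq q"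
  by (simp add: H_poly_eq_sigma_poly sigma_poly_in_Lnq)

text \<open>If \<open>a\<^sub>0 = 0\<close> the \<open>\<sigma>\<close>-degree drops below \<open>k\<close>; otherwise a kernel with \<open>q\<^sup>k\<close>
  elements would force \<open>N(a\<^sub>0) = (-1)\<^sup>n\<^sup>k N(\<eta> a\<^sub>0)\<close>.\<close>

lemma card_kernel_H_poly_le:
  assumes s: "gcd s (int n) = 1" and k: "0 < k"
    and eta: "\<eta> \<noteq> 0" "normq q n \<eta> \<noteq> (- 1) ^ (k * n)" and a: "\<exists>i<k. a i \<noteq> 0"
  shows "card {x::'a. H_poly q n k s \<eta> a x = 0} \<le> q ^ (k - 1)"
proof -
  let ?t = "nat (s mod int n)" and ?b = "a(k := \<eta> * a 0)"
  have cop: "coprime ?t n" by (rule coprime_nat_mod[OF s])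
  have H: "H_poly q n k s \<eta> a = sigma_poly q ?t ?b k" by (rule H_poly_eq_sigma_poly[OF k])
  show ?thesis
  proof (cases "a 0 = 0")
    case True
    have "sigma_poly q ?t ?b k x = sigma_poly q ?t a (k - 1) x" for x
      using k True sigma_poly_Suc[of q ?t ?b "k - 1" x] sigma_poly_cong[of "k - 1" ?b a q ?t x] by simp
    moreover obtain i where "i < k" "a i \<noteq> 0" using a by blast
    then have "\<exists>i\<le>k - 1. a i \<noteq> 0" by (intro exI[of _ i]) auto
    ultimately show ?thesis
      using card_sigma_poly_kernel_le[OF cop, of "k - 1" a] by (simp add: H)
  next
    case False
    then have top: "?b k \<noteq> 0" using eta(1) by simp
    note kernel = card_sigma_poly_kernel[where t="?t" and a="?b" and k=k, OF cop top]
    have "card {x::'a. sigma_poly q ?t ?b k x = 0} \<noteq> q ^ k"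
    proof
      assume "card {x::'a. sigma_poly q ?t ?b k x = 0} = q ^ k"
      then have "normq q n (a 0) = (- 1) ^ (n * k) * normq q n \<eta> * normq q n (a 0)"
        using kernel k by (simp add: normq_mult mult.assoc)
      then have "(- 1) ^ (n * k) * normq q n \<eta> = 1" using normq_nonzero[OF False] by simp
      then show False using eta(2) by (simp add: minus_one_power_mult_eq_1_iff mult.commute[of k n])
    qed
    then have "card {x::'a. H_poly q n k s \<eta> a x = 0} < q ^ k"
      using kernel H by simp
    then show ?thesis by (rule card_kernel_Lnq_le_pred[OF H_poly_in_Lnq[OF k]])
  qed
qed

lemma H_poly_nonzero:
  assumes "gcd s (int n) = 1" and "0 < k" "k \<le> n" and "\<eta> \<noteq> 0" "normq q n \<eta> \<noteq> (- 1) ^ (k * n)"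
    and "\<exists>i<k. a i \<noteq> 0"
  shows "H_poly q n k s \<eta> a \<noteq> (0 :: 'a \<Rightarrow> 'a)"
proof
  assume "H_poly q n k s \<eta> a = 0"
  then have "q ^ n \<le> q ^ (k - 1)"
    using card_kernel_H_poly_le[OF assms(1,2,4,5,6)] card_field by simp
  then show False using q_ge_2 assms(2,3) by (simp add: power_le_imp_le_exp)
qed

lemma card_H_code:
  assumes "gcd s (int n) = 1" and "0 < k" "k \<le> n" and "\<eta> \<noteq> 0" "normq q n \<eta> \<noteq> (- 1) ^ (k * n)"
  shows "card (H_code q n k s \<eta> :: ('a \<Rightarrow> 'a) set) = q ^ (n * k)"
proof -
  let ?H = "H_poly q n k s \<eta> :: (nat \<Rightarrow> 'a) \<Rightarrow> 'a \<Rightarrow> 'a"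
  have restrict: "?H (restrict a {..<k}) = ?H a" for a
    using assms(2) by (simp add: fun_eq_iff H_poly_apply)
  have "range ?H = ?H ` PiE {..<k} (\<lambda>_. UNIV)"
  proof (intro equalityI subsetI)
    fix f assume "f \<in> range ?H"
    then obtain a where "f = ?H a" by blast
    then show "f \<in> ?H ` PiE {..<k} (\<lambda>_. UNIV)"
      by (intro image_eqI[of _ _ "restrict a {..<k}"]) (simp_all add: restrict)
  qed auto
  moreover have "inj_on ?H (PiE {..<k} (\<lambda>_. UNIV))"
  proof (rule inj_onI)
    fix a b assume a: "a \<in> PiE {..<k} (\<lambda>_. UNIV)" and b: "b \<in> PiE {..<k} (\<lambda>_. UNIV)"
      and "?H a = ?H b"
    then have "?H (\<lambda>i. a i - b i) = 0"
      by (simp add: fun_eq_iff H_poly_apply algebra_simps sum_subtractf)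
    then have "\<forall>i<k. a i - b i = 0" using H_poly_nonzero[OF assms, of "\<lambda>i. a i - b i"] by auto
    then show "a = b" using a b by (intro PiE_ext) auto
  qed
  ultimately have "card (H_code q n k s \<eta> :: ('a \<Rightarrow> 'a) set) = card (PiE {..<k} (\<lambda>_. UNIV :: 'a set))"
    unfolding H_code_eq_range_H_poly by (simp only: card_image)
  also have "\<dots> = q ^ (n * k)" using card_field by (simp add: card_PiE power_mult)
  finally show ?thesis .
qed

lemma rank_comp_H_code_ge:
  assumes "gcd s (int n) = 1" and "0 < k" "k \<le> n" and "\<eta> \<noteq> 0" "normq q n \<eta> \<noteq> (- 1) ^ (k * n)"
    and "surj p" and "h \<in> H_code q n k s \<eta>" and "h \<circ> p \<noteq> (0 :: 'a \<Rightarrow> 'a)"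
  shows "n - k + 1 \<le> rk q (h \<circ> p)"
proof -
  obtain a where h: "h = H_poly q n k s \<eta> a" using assms(7) H_code_eq_range_H_poly by blast
  have h_L: "h \<in> Lnq q" using H_poly_in_Lnq[OF assms(2)] h by simp
  have "\<exists>i<k. a i \<noteq> 0"
  proof (rule ccontr)
    assume "\<not> (\<exists>i<k. a i \<noteq> 0)"
    then have "h = 0" using assms(2) by (simp add: h fun_eq_iff H_poly_apply)
    then show False using assms(8) by (simp add: fun_eq_iff)
  qed
  then have "card {x. h x = 0} \<le> q ^ (k - 1)"
    unfolding h by (rule card_kernel_H_poly_le[OF assms(1,2,4,5)])
  then have "n - (k - 1) \<le> rk q h" by (rule rank_ge_if_card_kernel_le[OF h_L])
  then show ?thesis using rk_comp_surj[OF assms(6)] assms(2,3) by simp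
qed

end

theorem theorem3p10:
  fixes C :: "('a::{field,finite} \<Rightarrow> 'a) set"
    and q n k :: nat and s :: int and p r :: "'a \<Rightarrow> 'a" and \<eta> :: 'a
  assumes q: "prime_power q" and n: "n > 0" and card: "card (UNIV :: 'a set) = q ^ n"
    and C_L: "C \<subseteq> Lnq q" and C_sub: "module.subspace scl C"
    and C_dim: "dim_L C = k" and k: "k > 2"
    and C_U1: "C \<inter> U1 q = {0}"
    and s: "gcd s (int n) = 1"
    and dim1: "dim_L (C \<inter> twist_code q n s C) = k - 2"
    and dim2: "dim_L (C \<inter> twist_code q n s C \<inter> twist_code q n (2 * s) C) = k - 3"
    and p_L: "p \<in> Lnq q" and r_L: "r \<in> Lnq q" and r_C: "r \<in> C"
    and decomp: "C = {a + b | a b. a \<in> span_L {twist q n (s * int i) p | i. 1 \<le> i \<and> i \<le> k - 1} \<and> b \<in> span_L {r}}"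
    and direct: "span_L {twist q n (s * int i) p | i. 1 \<le> i \<and> i \<le> k - 1} \<inter> span_L {r} = {0}"
    and p_inv: "bij p"
    and eta: "\<eta> \<noteq> 0" and eta_C: "p + scl \<eta> (twist q n (s * int k) p) \<in> C"
    and eta_norm: "normq q n \<eta> \<noteq> (-1) ^ (k * n)"
  shows "MRD q n C \<and> equivalent_codes q C (H_code q n k s \<eta>)"
proof -
  interpret Fqn_field q n by (rule Fqn_field.intro) (fact q n card)+
  have "k < n" using dim_lt_if_inter_U1[OF C_L C_sub C_U1] C_dim by simp
  then have H_hyps: "0 < k" "k \<le> n" using k by simp_all
  have twists: "twist q n (s * int i) p \<in> C" if "1 \<le> i" "i < k" for i
    unfolding decomp using that by (intro in_span_sum_if_in_left) auto
  have "card (H_code q n k s \<eta>) = card C"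
    using card_H_code[OF s H_hyps eta eta_norm] card_subspace_L[OF C_sub] C_dim card
    by (simp add: power_mult)
  then have C_eq: "(\<lambda>h. h \<circ> p) ` H_code q n k s \<eta> = C"
    using H_code_comp_eq_code[OF C_sub bij_is_surj[OF p_inv], of k q n s] twists eta_C by blast
  have "MRD q n C"
  proof (rule MRD_if_rank_ge[OF C_L C_sub C_dim H_hyps])
    fix f assume "f \<in> C" "f \<noteq> 0"
    then show "n - k + 1 \<le> rk q f"
      using rank_comp_H_code_ge[OF s H_hyps eta eta_norm bij_is_surj[OF p_inv]] C_eq by blast
  qed
  moreover have "equivalent_codes q C (H_code q n k s \<eta>)"
    using equivalent_codes_comp[OF p_L p_inv] C_eq by metis
  ultimately show ?thesis ..
qed

end
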